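(* Let $G$ be a finite graph (loops and multiple edges allowed) and $\mathfrak{p}\subseteq\Pi(G)$. The partition-selected chromatic, tension and flow polynomials are related to the partition-selected Tutte polynomial by $$\chi_G(\mathfrak{p},t)=(-1)^{r(G)}t^{c(G)}T_G(\mathfrak{p};1-t,0),$$ $$\tau_G(\mathfrak{p},t)=(-1)^{r(G)}T_G(\mathfrak{p};1-t,0),$$ $$\varphi_G(\mathfrak{p},t)=(-1)^{n(G)}T_G(\mathfrak{p};0,1-t).$$
   Context: For a finite graph $G=(V(G),E(G))$ and $S\subseteq E(G)$, put $S^c=E(G)\smallsetminus S$, let $c(S)$ be the number of connected components of the spanning subgraph $(V(G),S)$, $r(S)=|V(G)|-c(S)$, $n(S)=|S|-r(S)$; $c(G),r(G),n(G)$ denote the values at $S=E(G)$. Let $\pi(S)$ be the partition of $V(G)$ into the vertex sets of the components of $(V(G),S)$, and $\Pi(G)=\{\pi(S):S\subseteq E(G)\}$. Partition-selected polynomials for $\mathfrak{p}\subseteq\Pi(G)$: $\chi_G(\mathfrak{p},t)=\sum_{S\subseteq E(G),\,\pi(S)\in\mathfrak{p}}(-1)^{|S|}t^{c(S)}$, $\tau_G(\mathfrak{p},t)=\sum_{S\subseteq E(G),\,\pi(S)\in\mathfrak{p}}(-1)^{|S|}t^{r(G)-r(S)}$, $\varphi_G(\mathfrak{p},t)=\sum_{S\subseteq E(G),\,\pi(S)\in\mathfrak{p}}(-1)^{|S^c|}t^{n(S)}$, $R_G(\mathfrak{p};x,y)=\sum_{S\subseteq E(G),\,\pi(S)\in\mathfrak{p}}x^{r(G)-r(S)}y^{n(S)}$,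 $T_G(\mathfrak{p};x,y)=R_G(\mathfrak{p};x-1,y-1)$. All are $0$ when $\mathfrak{p}=\emptyset$. *)

theory Defs
  imports Main
begin

text \<open>
  Undirected multigraphs. \<open>ends e\<close> is the set of endpoints of the edge \<open>e\<close>: it has one element
  when \<open>e\<close> is a loop and two otherwise. Edges are objects of their own, so distinct edges may
  have the same endpoints. The empty graph is not excluded.
\<close>

record ('v, 'e) multigraph =
  verts :: "'v set"
  edges :: "'e set"
  ends :: "'e \<Rightarrow> 'v set"

definition finite_multigraph :: "('v, 'e) multigraph \<Rightarrow> bool" where
  "finite_multigraph G \<longleftrightarrow>
     finite (verts G) \<and> finite (edges G) \<and>
     (\<forall>e\<in>edges G. \<exists>u\<in>verts G. \<exists>v\<in>verts G. ends G e = {u, v})"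

definition adjacency :: "('v, 'e) multigraph \<Rightarrow> 'e set \<Rightarrow> ('v \<times> 'v) set" where
  "adjacency G S = {(u, v). \<exists>e\<in>S. ends G e = {u, v}}"

definition connectivity :: "('v, 'e) multigraph \<Rightarrow> 'e set \<Rightarrow> ('v \<times> 'v) set" where
  "connectivity G S = (adjacency G S)\<^sup>* \<inter> (verts G \<times> verts G)"

definition component_partition :: "('v, 'e) multigraph \<Rightarrow> 'e set \<Rightarrow> 'v set set" where
  "component_partition G S = verts G // connectivity G S"

definition graph_partitions :: "('v, 'e) multigraph \<Rightarrow> 'v set set set" where
  "graph_partitions G = component_partition G ` Pow (edges G)"

definition num_components :: "('v, 'e) multigraph \<Rightarrow> 'e set \<Rightarrow> nat" where
  "num_components G S = card (component_partition G S)"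

text \<open>
  For a finite multigraph and \<open>S \<subseteq> edges G\<close> one has \<open>num_components G S \<le> card (verts G)\<close>,
  \<open>graph_rank G S \<le> card S\<close> and \<open>graph_rank G S \<le> graph_rank G (edges G)\<close>, so the subtractions
  of natural numbers below are never truncated.
\<close>

definition graph_rank :: "('v, 'e) multigraph \<Rightarrow> 'e set \<Rightarrow> nat" where
  "graph_rank G S = card (verts G) - num_components G S"

definition graph_nullity :: "('v, 'e) multigraph \<Rightarrow> 'e set \<Rightarrow> nat" where
  "graph_nullity G S = card S - graph_rank G S"

text \<open>The edge sets over which all the partition-selected polynomials are summed.\<close>

definition selected :: "('v, 'e) multigraph \<Rightarrow> 'v set set set \<Rightarrow> 'e set set" where
  "selected G p = {S. S \<subseteq> edges G \<and> component_partition G S \<in> p}"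

text \<open>
  The polynomials have integer coefficients and are given through their values at elements of an
  arbitrary commutative ring. An identity between such values, for every commutative ring, includes
  the identity of formal polynomials: take the ring to be \<open>int poly\<close> and \<open>t\<close> its indeterminate.
\<close>

definition chromatic_sel ::
    "('v, 'e) multigraph \<Rightarrow> 'v set set set \<Rightarrow> 'a::comm_ring_1 \<Rightarrow> 'a" where
  "chromatic_sel G p t = (\<Sum>S\<in>selected G p. (-1) ^ card S * t ^ num_components G S)"

definition tension_sel ::
    "('v, 'e) multigraph \<Rightarrow> 'v set set set \<Rightarrow> 'a::comm_ring_1 \<Rightarrow> 'a" where
  "tension_sel G p t =
     (\<Sum>S\<in>selected G p. (-1) ^ card S * t ^ (graph_rank G (edges G) - graph_rank G S))"

definition flow_sel ::
    "('v, 'e) multigraph \<Rightarrow> 'v set set set \<Rightarrow> 'a::comm_ring_1 \<Rightarrow> 'a" where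
  "flow_sel G p t = (\<Sum>S\<in>selected G p. (-1) ^ card (edges G - S) * t ^ graph_nullity G S)"

definition rank_generating_sel ::
    "('v, 'e) multigraph \<Rightarrow> 'v set set set \<Rightarrow> 'a::comm_ring_1 \<Rightarrow> 'a \<Rightarrow> 'a" where
  "rank_generating_sel G p x y =
     (\<Sum>S\<in>selected G p. x ^ (graph_rank G (edges G) - graph_rank G S) * y ^ graph_nullity G S)"

definition tutte_sel ::
    "('v, 'e) multigraph \<Rightarrow> 'v set set set \<Rightarrow> 'a::comm_ring_1 \<Rightarrow> 'a \<Rightarrow> 'a" where
  "tutte_sel G p x y = rank_generating_sel G p (x - 1) (y - 1)"

end

theory Submission
  imports Defs
begin

text \<open>
  Substituting \<open>(1 - t, 0)\<close> or \<open>(0, 1 - t)\<close> in the Tutte polynomial evaluates the rank generating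
  polynomial at \<open>(- t, - 1)\<close> or \<open>(- 1, - t)\<close>, and the identities then hold summand by summand:
  whichever edge sets are selected, each one contributes the same power of \<open>t\<close> with the same sign on
  both sides. The signs match because \<open>r(G) + (r(G) - r(S)) + n(S)\<close> has the parity of \<open>card S\<close> and
  \<open>n(G) + (r(G) - r(S)) + n(S)\<close> that of \<open>card (E - S)\<close>, and the powers match because
  \<open>c(G) + (r(G) - r(S)) = c(S)\<close>.

  What makes this exponent bookkeeping valid is that rank and nullity are honest differences of
  natural numbers. This is the combinatorial content: \<open>c(S) \<le> card V\<close> (every component contains a
  vertex), \<open>r(S) \<le> r(G)\<close> (more edges only merge components), and \<open>r(S) \<le> card S\<close> (each edge merges
  at most two components into one, starting from the \<open>card V\<close> components of the edgeless graph).
\<close>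

lemma equiv_connectivity: "equiv (verts G) (connectivity G S)"
proof -
  have "sym (adjacency G S)"
    by (auto simp: sym_def adjacency_def insert_commute)
  then have "sym ((adjacency G S)\<^sup>*)"
    by (rule sym_rtrancl)
  then show ?thesis
    unfolding equiv_def connectivity_def refl_on_def sym_def trans_def
    by (auto intro: rtrancl_trans)
qed

lemma finite_component_partition:
  assumes "finite (verts G)"
  shows "finite (component_partition G S)"
  unfolding component_partition_def
  by (rule finite_quotient[OF assms]) (auto simp: connectivity_def)

lemma num_components_le_card_verts:
  assumes "finite (verts G)"
  shows "num_components G S \<le> card (verts G)"
proof -
  have "component_partition G S = (\<lambda>v. connectivity G S `` {v}) ` verts G"
    by (auto simp: component_partition_def quotient_def)
  then show ?thesis
    by (simp add: num_components_def card_image_le[OF assms])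
qed

lemma num_components_antimono:
  assumes "finite (verts G)" and "S \<subseteq> T"
  shows "num_components G T \<le> num_components G S"
proof -
  have "adjacency G S \<subseteq> adjacency G T"
    using assms(2) by (auto simp: adjacency_def)
  then have "connectivity G S \<subseteq> connectivity G T"
    using rtrancl_mono unfolding connectivity_def by blast
  then show ?thesis
    using finite_component_partition[OF assms(1), of S]
    unfolding num_components_def component_partition_def
    by (intro finite_refines_card_le equiv_connectivity)
qed

lemma num_components_no_edges: "num_components G {} = card (verts G)"
proof -
  have "component_partition G {} = (\<lambda>v. {v}) ` verts G"
    by (auto simp: component_partition_def quotient_def connectivity_def adjacency_def)
  then show ?thesis
    by (simp add: num_components_def card_image)
qed

text \<open>
  A walk that uses a new edge between \<open>u\<close> and \<open>v\<close> can be shortened until it uses that edge at most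
  once.
\<close>

lemma connected_via_new_edge:
  assumes "(x, y) \<in> (adjacency G (insert e S))\<^sup>*" and e: "ends G e = {u, v}"
  defines "R \<equiv> (adjacency G S)\<^sup>*"
  shows "(x, y) \<in> R \<or> (x, u) \<in> R \<and> (v, y) \<in> R \<or> (x, v) \<in> R \<and> (u, y) \<in> R"
  using assms(1)
proof (induction rule: rtrancl_induct)
  case base
  show ?case by (simp add: R_def)
next
  case (step y z)
  have R: "(b, d) \<in> R" if "(b, c) \<in> R" "(c, d) \<in> R" for b c d
    using that unfolding R_def by (rule rtrancl_trans)
  have refl: "(b, b) \<in> R" for b
    by (simp add: R_def)
  from step.hyps(2) e consider "(y, z) \<in> adjacency G S" | "y = u" "z = v" | "y = v" "z = u"
    by (auto simp: adjacency_def doubleton_eq_iff)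
  then show ?case
  proof cases
    case 1
    then have "(y, z) \<in> R"
      by (auto simp: R_def)
    with step.IH R show ?thesis
      by blast
  qed (use step.IH refl R in blast)+
qed

text \<open>
  A new edge between \<open>u\<close> and \<open>v\<close> can only merge the old components of \<open>u\<close> and \<open>v\<close>. Leaving out the
  old component of \<open>v\<close>, distinct old components therefore still lie in distinct new ones.
\<close>

lemma num_components_insert_edge:
  assumes fin: "finite (verts G)" and v: "v \<in> verts G" and e: "ends G e = {u, v}"
  shows "num_components G S \<le> num_components G (insert e S) + 1"
proof -
  let ?C = "connectivity G S" and ?C' = "connectivity G (insert e S)"
  let ?K = "component_partition G S" and ?K' = "component_partition G (insert e S)"
  let ?B = "?C `` {v}"
  note eq = equiv_connectivity[of G S] and eq' = equiv_connectivity[of G "insert e S"]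
  have sym: "(y, x) \<in> ?C" if "(x, y) \<in> ?C" for x y
    using eq that by (meson equivE symD)
  \<comment> \<open>A vertex of an old component represents the new component that contains it.\<close>
  define f where "f = (\<lambda>X. ?C' `` {SOME x. x \<in> X})"
  have rep: "(SOME x. x \<in> X) \<in> X" if "X \<in> ?K" for X
    using in_quotient_imp_non_empty[OF eq] that some_in_eq
    unfolding component_partition_def by blast
  have sub: "X \<subseteq> verts G" if "X \<in> ?K" for X
    using in_quotient_imp_subset[OF eq] that unfolding component_partition_def by blast
  have "f ` (?K - {?B}) \<subseteq> ?K'"
    unfolding f_def using rep sub by (auto simp: component_partition_def intro!: quotientI)
  moreover have "inj_on f (?K - {?B})"
  proof (rule inj_onI)
    fix X Y
    assume X: "X \<in> ?K - {?B}" and Y: "Y \<in> ?K - {?B}" and "f X = f Y"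
    define x y where "x = (SOME x. x \<in> X)" and "y = (SOME y. y \<in> Y)"
    have x: "x \<in> X" "x \<in> verts G" and y: "y \<in> Y" "y \<in> verts G"
      using rep sub X Y unfolding x_def y_def by blast+
    have XY: "X = ?C `` {x}" "Y = ?C `` {y}"
      using X Y x y eq unfolding component_partition_def
      by (metis DiffD1 Image_singleton_iff equiv_class_eq quotientE)+
    have "(x, v) \<notin> ?C" and "(y, v) \<notin> ?C"
      using X Y XY equiv_class_eq[OF eq] by auto
    then have nv: "(x, v) \<notin> (adjacency G S)\<^sup>*" "(v, y) \<notin> (adjacency G S)\<^sup>*"
      using x y v sym unfolding connectivity_def by blast+
    have "(x, y) \<in> ?C'"
      using \<open>f X = f Y\<close> x y eq_equiv_class_iff[OF eq'] unfolding f_def x_def y_def by blast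
    then have "(x, y) \<in> (adjacency G (insert e S))\<^sup>*"
      by (simp add: connectivity_def)
    from connected_via_new_edge[OF this e] nv have "(x, y) \<in> ?C"
      using x y by (auto simp: connectivity_def)
    then show "X = Y"
      using XY equiv_class_eq[OF eq] by blast
  qed
  ultimately have "card (?K - {?B}) \<le> card ?K'"
    by (meson card_inj_on_le finite_component_partition[OF fin])
  moreover have "card ?K \<le> card (?K - {?B}) + 1"
    using card_Diff1_le diff_card_le_card_Diff[of "{?B}" ?K] by simp
  ultimately show ?thesis
    by (simp add: num_components_def)
qed

lemma card_verts_le_num_components_plus_card:
  assumes G: "finite_multigraph G" and "S \<subseteq> edges G"
  shows "card (verts G) \<le> num_components G S + card S"
proof -
  have "finite S"
    using assms by (auto simp: finite_multigraph_def intro: finite_subset)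
  then show ?thesis
    using assms(2)
  proof (induction rule: finite_induct)
    case empty
    then show ?case by (simp add: num_components_no_edges)
  next
    case (insert e S)
    then obtain u v where "v \<in> verts G" "ends G e = {u, v}"
      using G unfolding finite_multigraph_def by blast
    then have "num_components G S \<le> num_components G (insert e S) + 1"
      using G num_components_insert_edge by (auto simp: finite_multigraph_def)
    with insert show ?case by simp
  qed
qed

lemma graph_rank_mono:
  assumes "finite (verts G)" and "S \<subseteq> T"
  shows "graph_rank G S \<le> graph_rank G T"
  using num_components_antimono[OF assms] by (simp add: graph_rank_def)

lemma graph_rank_le_card:
  assumes "finite_multigraph G" and "S \<subseteq> edges G"
  shows "graph_rank G S \<le> card S"
  using card_verts_le_num_components_plus_card[OF assms] by (simp add: graph_rank_def)

lemma num_components_eq_plus_rank_diff: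
  assumes "finite (verts G)" and "S \<subseteq> T"
  shows "num_components G S = num_components G T + (graph_rank G T - graph_rank G S)"
  using num_components_le_card_verts[OF assms(1), of S] num_components_antimono[OF assms]
  unfolding graph_rank_def by linarith

lemma minus_one_power_cong:
  "(-1 :: 'a::ring_1) ^ m = (-1) ^ n" if "even m \<longleftrightarrow> even n"
  using that by (cases "even m") auto

theorem theorem3p1:
  fixes G :: "('v, 'e) multigraph"
    and p :: "'v set set set"
    and t :: "'a::comm_ring_1"
  assumes "finite_multigraph G"
    and "p \<subseteq> graph_partitions G"
  shows "chromatic_sel G p t =
           (-1) ^ graph_rank G (edges G) * t ^ num_components G (edges G) * tutte_sel G p (1 - t) 0
       \<and> tension_sel G p t = (-1) ^ graph_rank G (edges G) * tutte_sel G p (1 - t) 0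
       \<and> flow_sel G p t = (-1) ^ graph_nullity G (edges G) * tutte_sel G p 0 (1 - t)"
proof -
  let ?E = "edges G"
  let ?d = "\<lambda>S. graph_rank G ?E - graph_rank G S"
  have fin: "finite (verts G)" "finite ?E"
    using assms(1) by (auto simp: finite_multigraph_def)
  have minus_power: "(- t) ^ k = (-1) ^ k * t ^ k" for k
    by (rule power_minus)

  have tension_sign: "(-1 :: 'a) ^ card S = (-1) ^ (graph_rank G ?E + ?d S + graph_nullity G S)"
    if "S \<subseteq> ?E" for S
    using graph_rank_mono[OF fin(1) that] graph_rank_le_card[OF assms(1) that]
    by (intro minus_one_power_cong) (simp add: graph_nullity_def)
  have flow_sign: "(-1 :: 'a) ^ card (?E - S) = (-1) ^ (graph_nullity G ?E + ?d S + graph_nullity G S)"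
    if "S \<subseteq> ?E" for S
    using graph_rank_mono[OF fin(1) that] graph_rank_le_card[OF assms(1) that]
      graph_rank_le_card[OF assms(1) order_refl] card_mono[OF fin(2) that]
    by (intro minus_one_power_cong)
      (auto simp: graph_nullity_def card_Diff_subset[OF finite_subset[OF that fin(2)] that])

  have tension: "tension_sel G p t = (-1) ^ graph_rank G ?E * tutte_sel G p (1 - t) 0"
    unfolding tension_sel_def tutte_sel_def rank_generating_sel_def sum_distrib_left
    by (rule sum.cong) (auto simp: selected_def tension_sign minus_power power_add mult_ac)
  have "chromatic_sel G p t = t ^ num_components G ?E * tension_sel G p t"
    unfolding chromatic_sel_def tension_sel_def sum_distrib_left
  proof (rule sum.cong[OF refl])
    fix S assume "S \<in> selected G p"
    then have "num_components G S = num_components G ?E + ?d S"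
      by (intro num_components_eq_plus_rank_diff fin) (simp add: selected_def)
    then show "(-1) ^ card S * t ^ num_components G S =
        t ^ num_components G ?E * ((-1) ^ card S * t ^ ?d S)"
      by (simp add: power_add mult_ac)
  qed
  with tension have "chromatic_sel G p t =
      (-1) ^ graph_rank G ?E * t ^ num_components G ?E * tutte_sel G p (1 - t) 0"
    by (simp add: mult_ac)
  moreover have "flow_sel G p t = (-1) ^ graph_nullity G ?E * tutte_sel G p 0 (1 - t)"
    unfolding flow_sel_def tutte_sel_def rank_generating_sel_def sum_distrib_left
    by (rule sum.cong) (auto simp: selected_def flow_sign minus_power power_add mult_ac)
  ultimately show ?thesis
    using tension by blast
qed

end
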